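(* Let $s$ and $d$ be relatively prime positive integers. The number of self-conjugate $(s,s+d,s+2d)$-core partitions is \[ \sum_{i=0}^{\lfloor s/4 \rfloor} \binom{\frac{s+d-1}{2}}{i,\ \frac{d}{2}+i,\ \frac{s-1}{2}-2i}\qquad\text{if $d$ is even,} \] and \[ \sum_{i=0}^{\lfloor s/2\rfloor} \binom{\lfloor \frac{s+d-1}{2}\rfloor}{\lfloor \frac{i}{2} \rfloor,\ \lfloor \frac{d+i}{2}\rfloor,\ \lfloor \frac{s}{2} \rfloor -i}\qquad\text{if $d$ is odd.} \]
   Context: A partition is a finite (possibly empty) non-increasing sequence of positive integers, identified with its Young diagram. The hook length of a box is the number of boxes to its right in the same row plus the number of boxes below it in the same column plus $1$. A partition is an $s$-core if no box has hook length $s$, and an $(s_1,\dots,s_q)$-core if it is an $s_i$-core for every $i$. A partition is self-conjugate if its Young diagram is invariant under reflection in the main diagonal. $\binom{n}{x,y,z}=\frac{n!}{x!\,y!\,z!}$ (with $x+y+z=n$) is the multinomial coefficient. *)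

theory Defs
  imports Main
begin

definition is_partition :: "nat list \<Rightarrow> bool" where
  "is_partition p \<longleftrightarrow> sorted_wrt (\<ge>) p \<and> (\<forall>k\<in>set p. 0 < k)"

text \<open>Boxes are pairs (row, column), both counted from 0, with rows numbered downwards.\<close>

definition young_diagram :: "nat list \<Rightarrow> (nat \<times> nat) set" where
  "young_diagram p = {(i, j). i < length p \<and> j < p ! i}"

definition hook_length :: "nat list \<Rightarrow> nat \<times> nat \<Rightarrow> nat" where
  "hook_length p = (\<lambda>(i, j).
     card {j'. j < j' \<and> (i, j') \<in> young_diagram p} +
     card {i'. i < i' \<and> (i', j) \<in> young_diagram p} + 1)"

definition is_core :: "nat \<Rightarrow> nat list \<Rightarrow> bool" where
  "is_core s p \<longleftrightarrow> (\<forall>b\<in>young_diagram p. hook_length p b \<noteq> s)"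

definition self_conjugate :: "nat list \<Rightarrow> bool" where
  "self_conjugate p \<longleftrightarrow> prod.swap ` young_diagram p = young_diagram p"

definition self_conjugate_cores :: "nat set \<Rightarrow> nat list set" where
  "self_conjugate_cores S = {p. is_partition p \<and> self_conjugate p \<and> (\<forall>s\<in>S. is_core s p)}"

text \<open>Meant for arguments with \<open>x + y + z = n\<close> only; then the division is exact.\<close>

definition trinomial :: "nat \<Rightarrow> nat \<Rightarrow> nat \<Rightarrow> nat \<Rightarrow> nat" where
  "trinomial n x y z = fact n div (fact x * fact y * fact z)"

end

theory Submission
  imports Defs "HOL-Combinatorics.Multiset_Permutations"
begin

text \<open>
  A self-conjugate partition is determined by its beta-set \<open>B = {p\<^sub>i - i - 1}\<close>, and the sets that arise
  are exactly those bounded above with \<open>n \<in> B \<longleftrightarrow> -1 - n \<notin> B\<close>; being a \<open>t\<close>-core means that \<open>B\<close> is closed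
  under subtracting \<open>t\<close>. Put \<open>a = s + d\<close> and write integers as \<open>n0 + a u + d x\<close>, uniquely up to
  \<open>(u, x) \<mapsto> (u - d, x + a)\<close>. Closure under \<open>a\<close> turns \<open>B\<close> into the region \<open>u \<le> H x\<close> below a profile
  \<open>H\<close>, closure under \<open>a - d\<close> and \<open>a + d\<close> says that \<open>H\<close> has steps \<open>-1\<close>, \<open>0\<close>, \<open>1\<close>, and moreover
  \<open>H (x + a) = H x - d\<close>. The symmetry of \<open>B\<close> makes \<open>H\<close> odd about a centre, so \<open>H\<close> is
  determined by \<open>k = \<lfloor>(a - 1) / 2\<rfloor>\<close> consecutive steps, whose sum \<open>S\<close> is only
  constrained by \<open>\<bar>2 S + d\<bar> \<le> 1\<close>. Sorting these paths by their numbers of up and down steps gives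
  the trinomial sums.
\<close>

section \<open>Beta-sets of self-conjugate partitions\<close>

definition row :: "nat list \<Rightarrow> nat \<Rightarrow> nat" where
  "row p i = (if i < length p then p ! i else 0)"

definition beta :: "nat list \<Rightarrow> nat \<Rightarrow> int" where
  "beta p i = int (row p i) - int i - 1"

definition balanced :: "int set \<Rightarrow> bool" where
  "balanced B \<longleftrightarrow> (\<forall>n. n \<in> B \<longleftrightarrow> - 1 - n \<notin> B)"

definition closed_under :: "int \<Rightarrow> int set \<Rightarrow> bool" where
  "closed_under t B \<longleftrightarrow> (\<forall>n\<in>B. n - t \<in> B)"

lemma mem_young_diagram: "(i, j) \<in> young_diagram p \<longleftrightarrow> j < row p i"
  by (auto simp: young_diagram_def row_def)

lemma row_antimono:
  assumes "is_partition p" "i \<le> j"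
  shows "row p j \<le> row p i"
  using assms unfolding is_partition_def row_def
  by (cases "i = j") (auto simp: sorted_wrt_iff_nth_less)

lemma row_pos_iff: "is_partition p \<Longrightarrow> 0 < row p i \<longleftrightarrow> i < length p"
  by (auto simp: is_partition_def row_def)

lemma self_conjugate_iff_row:
  "self_conjugate p \<longleftrightarrow> (\<forall>i j. j < row p i \<longleftrightarrow> i < row p j)"
proof
  assume sc: "self_conjugate p"
  have "i < row p j" if "j < row p i" for i j
  proof -
    have "prod.swap (i, j) \<in> prod.swap ` young_diagram p"
      using that by (intro imageI) (simp add: mem_young_diagram)
    then have "prod.swap (i, j) \<in> young_diagram p"
      using sc by (simp only: self_conjugate_def)
    then show ?thesis
      by (simp add: mem_young_diagram)
  qed
  then show "\<forall>i j. j < row p i \<longleftrightarrow> i < row p j" by blast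
next
  assume sym: "\<forall>i j. j < row p i \<longleftrightarrow> i < row p j"
  have "x \<in> prod.swap ` young_diagram p \<longleftrightarrow> x \<in> young_diagram p" for x
  proof -
    have "x \<in> prod.swap ` young_diagram p \<longleftrightarrow> prod.swap x \<in> young_diagram p"
      by (metis imageE imageI swap_swap)
    then show ?thesis using sym by (cases x) (simp only: mem_young_diagram swap_simp)
  qed
  then show "self_conjugate p" unfolding self_conjugate_def by blast
qed

text \<open>In a self-conjugate diagram the column lengths are the row lengths, so the leg of \<open>(i, j)\<close>
  is read off from row \<open>j\<close>.\<close>

lemma hook_length_self_conjugate:
  assumes "self_conjugate p" "j < row p i"
  shows "int (hook_length p (i, j)) = beta p i + beta p j + 1"
proof -
  have sym: "j' < row p i' \<longleftrightarrow> i' < row p j'" for i' j'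
    using assms(1) by (simp add: self_conjugate_iff_row)
  have "{j'. j < j' \<and> (i, j') \<in> young_diagram p} = {j<..<row p i}"
    by (auto simp: mem_young_diagram)
  moreover have "{i'. i < i' \<and> (i', j) \<in> young_diagram p} = {i<..<row p j}"
    by (auto simp: mem_young_diagram sym[of j])
  moreover have "i < row p j" using assms(2) sym by blast
  ultimately show ?thesis
    using assms(2) by (simp add: hook_length_def beta_def)
qed

lemma beta_strict_antimono:
  assumes "is_partition p" "i < j"
  shows "beta p j < beta p i"
  using row_antimono[of p i j] assms by (simp add: beta_def)

text \<open>By symmetry, \<open>j < row p i\<close> and \<open>i < row p j\<close> hold or fail
  together, so \<open>row p i + row p j\<close> is at least \<open>i + j + 2\<close> or at most
  \<open>i + j\<close>. It is never \<open>i + j + 1\<close>, the value that two beta-numbers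
  summing to -1 would need.\<close>

lemma balanced_range_beta:
  assumes "is_partition p" "self_conjugate p"
  shows "balanced (range (beta p))"
proof -
  have sym: "j < row p i \<longleftrightarrow> i < row p j" for i j
    using assms(2) by (simp add: self_conjugate_iff_row)
  have no: "- 1 - n \<notin> range (beta p)" if n: "n \<in> range (beta p)" for n
  proof
    assume "- 1 - n \<in> range (beta p)"
    with n obtain i j where "n = beta p i" "- 1 - n = beta p j" by blast
    then have "int (row p i) + int (row p j) = int i + int j + 1"
      by (simp add: beta_def)
    moreover have "(j < row p i \<and> i < row p j) \<or> (row p i \<le> j \<and> row p j \<le> i)"
      using sym[of j i] by linarith
    ultimately show False by linarith
  qed
  have yes: "- 1 - n \<in> range (beta p)" if n: "n \<notin> range (beta p)" for n
  proof -
    have ex: "\<exists>i. beta p i < n"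
      by (rule exI[of _ "length p + nat (\<bar>n\<bar>)"]) (simp add: beta_def row_def)
    \<comment> \<open>All beta-numbers before position \<open>i\<close> exceed \<open>n\<close>.
      Hence column \<open>j = n + i\<close> has height exactly \<open>i\<close>; by symmetry row
      \<open>j\<close> has length \<open>i\<close>, which gives
      \<open>beta p j = i - j - 1 = - 1 - n\<close>.\<close>
    define i where "i = (LEAST i. beta p i < n)"
    have i: "beta p i < n" unfolding i_def by (rule LeastI_ex[OF ex])
    define j where "j = nat (n + int i)"
    have j: "int j = n + int i" using i by (simp add: j_def beta_def)
    have "\<not> j < row p i" using i j by (simp add: beta_def)
    then have 1: "row p j \<le> i" using sym[of j i] by linarith
    have 2: "i \<le> row p j"
    proof (cases i)
      case (Suc i')
      have "\<not> beta p i' < n" using not_less_Least[of i' "\<lambda>i. beta p i < n"] Suc by (simp add: i_def)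
      moreover have "beta p i' \<noteq> n" using n by blast
      ultimately have "n < beta p i'" by simp
      then have "j < row p i'" using j Suc by (simp add: beta_def)
      then show ?thesis using sym[of j i'] Suc by simp
    qed simp
    have "beta p j = - 1 - n" using 1 2 j by (simp add: beta_def)
    then show ?thesis by (metis rangeI)
  qed
  show ?thesis unfolding balanced_def using no yes by blast
qed

text \<open>A hook of length \<open>t\<close> at \<open>(i, j)\<close> means
  \<open>beta p j = - 1 - (beta p i - t)\<close>; by balance, such a \<open>j\<close> exists iff
  \<open>beta p i - t\<close> is missing from the beta-set.\<close>

lemma is_core_iff_closed_under:
  assumes "is_partition p" "self_conjugate p" "0 < t"
  shows "is_core t p \<longleftrightarrow> closed_under (int t) (range (beta p))"
proof -
  note bal = balanced_range_beta[OF assms(1,2)]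
  have sym: "j < row p i \<longleftrightarrow> i < row p j" for i j
    using assms(2) by (simp add: self_conjugate_iff_row)
  \<comment> \<open>Outside the diagram \<open>row p i \<le> j\<close> and
    \<open>row p j \<le> i\<close>, which makes this sum negative. So every solution of the hook
    equation is a genuine box.\<close>
  have box: "j < row p i" if "beta p i + beta p j + 1 > 0" for i j
    using that sym[of j i] unfolding beta_def by linarith
  have "is_core t p \<longleftrightarrow> (\<forall>i j. j < row p i \<longrightarrow> beta p i + beta p j + 1 \<noteq> int t)"
    unfolding is_core_def
    by (auto simp: mem_young_diagram Ball_def hook_length_self_conjugate[OF assms(2), symmetric])
  also have "\<dots> \<longleftrightarrow> (\<forall>i j. beta p i + beta p j + 1 \<noteq> int t)"
  proof -
    have "j < row p i" if "beta p i + beta p j + 1 = int t" for i j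
      using that \<open>0 < t\<close> by (intro box) simp
    then show ?thesis by blast
  qed
  also have "\<dots> \<longleftrightarrow> (\<forall>i. - 1 - (beta p i - int t) \<notin> range (beta p))"
  proof -
    have "- 1 - (beta p i - int t) \<notin> range (beta p) \<longleftrightarrow>
        (\<forall>j. beta p i + beta p j + 1 \<noteq> int t)" for i
    proof -
      have "- 1 - (beta p i - int t) = beta p j \<longleftrightarrow> beta p i + beta p j + 1 = int t" for j
        by linarith
      then show ?thesis by (simp add: image_iff)
    qed
    then show ?thesis by simp
  qed
  also have "\<dots> \<longleftrightarrow> closed_under (int t) (range (beta p))"
    using bal unfolding balanced_def closed_under_def by blast
  finally show ?thesis .
qed

text \<open>A decreasing enumeration is determined by its set of values: once the earlier positions
  agree, neither sequence can have taken the other's \<open>n\<close>-th value before position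
  \<open>n\<close>.\<close>

lemma strict_antimono_range_unique:
  fixes b c :: "nat \<Rightarrow> int"
  assumes b: "\<And>i j. i < j \<Longrightarrow> b j < b i" and c: "\<And>i j. i < j \<Longrightarrow> c j < c i"
    and range: "range b = range c"
  shows "b = c"
proof
  fix n show "b n = c n"
  proof (induction n rule: less_induct)
    case (less n)
    obtain m where m: "b n = c m" using range by (metis rangeE rangeI)
    have "\<not> m < n" using less[of m] b[of m n] m by auto
    then have 1: "b n \<le> c n" using m c[of n m] by (cases "m = n") auto
    obtain l where l: "c n = b l" using range by (metis rangeE rangeI)
    have "\<not> l < n" using less[of l] c[of l n] l by auto
    then have "c n \<le> b n" using l b[of n l] by (cases "l = n") auto
    with 1 show ?case by simp
  qed
qed

lemma range_beta_inj:
  assumes "is_partition p" "is_partition q" "range (beta p) = range (beta q)"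
  shows "p = q"
proof -
  have "beta p = beta q"
    using assms by (intro strict_antimono_range_unique) (auto simp: beta_strict_antimono)
  then have row: "row p i = row q i" for i by (auto simp: beta_def fun_eq_iff)
  have "i < length p \<longleftrightarrow> i < length q" for i
    using row_pos_iff[OF assms(1)] row_pos_iff[OF assms(2)] row by metis
  then have len: "length p = length q" by (meson linorder_neqE_nat less_irrefl)
  show ?thesis
  proof (rule nth_equalityI[OF len])
    fix i assume "i < length p"
    then show "p ! i = q ! i" using row[of i] len by (simp add: row_def)
  qed
qed

text \<open>The window splits into \<open>m\<close> pairs \<open>{n, - 1 - n}\<close>, and a
  balanced set contains exactly one element of each.\<close>

lemma card_balanced_window:
  assumes "balanced B"
  shows "card (B \<inter> {- int m..<int m}) = m"
proof (induction m)
  case (Suc m)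
  let ?A = "B \<inter> {- int m..<int m}"
  have iff: "int m \<in> B \<longleftrightarrow> - 1 - int m \<notin> B" using assms unfolding balanced_def by (rule spec)
  have "B \<inter> {- int (Suc m)..<int (Suc m)} =
      insert (if int m \<in> B then int m else - 1 - int m) ?A"
  proof -
    have *: "{- int (Suc m)..<int (Suc m)} = insert (int m) (insert (- 1 - int m) {- int m..<int m})"
      by auto
    show ?thesis
    proof (cases "int m \<in> B")
      case True
      with iff have "- 1 - int m \<notin> B" by simp
      with True show ?thesis unfolding * by auto
    next
      case False
      with iff have "- 1 - int m \<in> B" by simp
      with False show ?thesis unfolding * by auto
    qed
  qed
  then show ?case using Suc by auto
qed simp

lemma ex_row_of_antimono:
  fixes P :: "nat \<Rightarrow> bool"
  assumes "\<And>i j. i \<le> j \<Longrightarrow> P j \<Longrightarrow> P i" "\<not> P N"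
  shows "\<exists>r. \<forall>j. P j \<longleftrightarrow> j < r"
proof -
  have "P j \<longleftrightarrow> j < (LEAST r. \<not> P r)" for j
  proof
    assume "P j"
    then show "j < (LEAST r. \<not> P r)"
      using assms(1)[of "LEAST r. \<not> P r" j] LeastI[of "\<lambda>r. \<not> P r", OF assms(2)] by (metis not_le)
  qed (use not_less_Least in blast)
  then show ?thesis by blast
qed

text \<open>The diagram is rebuilt from the counting function \<open>C\<close>. Balance yields
  \<open>C (- m) = C m + m\<close>, and this is what makes the diagram symmetric.\<close>

lemma range_beta_surj:
  assumes bal: "balanced B" and bdd: "bdd_above B"
  shows "\<exists>p. is_partition p \<and> self_conjugate p \<and> range (beta p) = B"
proof -
  obtain M where "\<And>x. x \<in> B \<Longrightarrow> x \<le> M"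
    using bdd unfolding bdd_above_def by blast
  then obtain N where N: "\<And>x. x \<in> B \<Longrightarrow> x < N"
    by (meson less_add_one order_le_less_trans)
  define C where "C m = card {x \<in> B. m \<le> x}" for m
  have fin: "finite {x \<in> B. m \<le> x}" for m
    by (rule finite_subset[of _ "{m..<N}"]) (use N in auto)
  have C_step: "C m = C (m + 1) + (if m \<in> B then 1 else 0)" for m
  proof -
    have "{x \<in> B. m \<le> x} = (if m \<in> B then insert m {x \<in> B. m + 1 \<le> x} else {x \<in> B. m + 1 \<le> x})"
      by (auto simp: order_le_less)
    then show ?thesis using fin by (simp add: C_def)
  qed
  have C_anti: "C n \<le> C m" if "m \<le> n" for m n
  proof -
    have "{x \<in> B. n \<le> x} \<subseteq> {x \<in> B. m \<le> x}" using that by (blast intro: order_trans)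
    then show ?thesis unfolding C_def by (rule card_mono[OF fin])
  qed
  have C_refl': "C (- int m) = C (int m) + m" for m
  proof -
    have "{x \<in> B. - int m \<le> x} = {x \<in> B. int m \<le> x} \<union> (B \<inter> {- int m..<int m})" by auto
    then have "C (- int m) = C (int m) + card (B \<inter> {- int m..<int m})"
      unfolding C_def by (simp add: fin card_Un_disjoint disjoint_iff)
    then show ?thesis by (simp add: card_balanced_window[OF bal])
  qed
  have C_refl: "int (C (- m)) = int (C m) + m" for m :: int
    using C_refl'[of "nat m"] C_refl'[of "nat (- m)"] by (cases "m \<ge> 0") auto
  \<comment> \<open>\<open>P i j\<close> is membership of \<open>(i, j)\<close> in the diagram: row \<open>i\<close> extends beyond column \<open>j\<close>
    iff at least \<open>i + 1\<close> elements of \<open>B\<close> are \<open>\<ge> j - i\<close>.\<close>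
  define P where "P i j \<longleftrightarrow> i < C (int j - int i)" for i j :: nat
  have P_sym: "P i j \<longleftrightarrow> P j i" for i j
    using C_refl[of "int j - int i"] by (auto simp: P_def)
  have P_anti: "P i j" if "j \<le> j'" "P i j'" for i j j'
    using that C_anti[of "int j - int i" "int j' - int i"] by (simp add: P_def)
  have C0: "C m = 0" if "N \<le> m" for m
  proof -
    have "{x \<in> B. m \<le> x} = {}" using N that by force
    then show ?thesis unfolding C_def by (simp only: card.empty)
  qed
  have notP: "\<not> P i (i + nat N)" for i
    using C0[of "int (nat N)"] by (simp add: P_def)
  have "\<exists>r. \<forall>j. P i j \<longleftrightarrow> j < r" for i
    by (rule ex_row_of_antimono[where P = "P i", OF _ notP]) (rule P_anti)
  then obtain r where r: "\<And>i j. P i j \<longleftrightarrow> j < r i" by metis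
  have r_anti: "r j \<le> r i" if "i \<le> j" for i j
  proof (rule ccontr)
    assume "\<not> r j \<le> r i"
    then have "P j (r i)" using r by simp
    then have "P (r i) j" by (rule P_sym[THEN iffD1])
    then have "P (r i) i" by (rule P_anti[OF that])
    then have "P i (r i)" by (rule P_sym[THEN iffD1])
    then show False using r by simp
  qed
  define p where "p = map r [0..<r 0]"
  have r_pos: "0 < r i \<longleftrightarrow> i < r 0" for i
    unfolding r[symmetric] by (rule P_sym)
  have row_p: "row p i = r i" for i
    using r_pos[of i] by (auto simp: row_def p_def)
  have part: "is_partition p"
    unfolding is_partition_def
  proof
    show "sorted_wrt (\<ge>) p" using r_anti by (simp add: p_def sorted_wrt_iff_nth_less)
    show "\<forall>k\<in>set p. 0 < k"
    proof
      fix k assume "k \<in> set p"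
      then obtain i where "i < r 0" "k = r i" by (auto simp: p_def)
      then show "0 < k" using r_pos[of i] by blast
    qed
  qed
  have sc: "self_conjugate p"
    unfolding self_conjugate_iff_row row_p r[symmetric] by (intro allI P_sym)
  \<comment> \<open>The end of row \<open>i\<close> is where \<open>C\<close> drops from above
    \<open>i\<close> to at most \<open>i\<close>, and \<open>C\<close> drops only at elements of
    \<open>B\<close>. An empty row has no last box to test, so there the reflection formula for
    \<open>C\<close> is used.\<close>
  have sub: "beta p i \<in> B" for i
  proof -
    let ?n = "int (r i) - int i - 1"
    have 1: "C (?n + 1) \<le> i" using r[of i "r i"] by (simp add: P_def)
    have 2: "i < C ?n"
    proof (cases "r i")
      case 0
      have eq: "int (r i) - int i - 1 = - int (Suc i)" using 0 by simp
      show ?thesis unfolding eq C_refl' by simp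
    next
      case (Suc j)
      then show ?thesis using r[of i j] by (simp add: P_def)
    qed
    have "?n \<in> B" using C_step[of ?n] 1 2 by (auto split: if_splits)
    then show ?thesis by (simp add: beta_def row_p)
  qed
  have bal': "balanced (range (beta p))" by (rule balanced_range_beta[OF part sc])
  \<comment> \<open>Both sets contain exactly one of \<open>n\<close> and \<open>- 1 - n\<close>, so
    the inclusion just shown forces equality.\<close>
  have "n \<in> range (beta p)" if "n \<in> B" for n
  proof (rule ccontr)
    assume "n \<notin> range (beta p)"
    then have "- 1 - n \<in> range (beta p)" using bal' unfolding balanced_def by blast
    then obtain i where "- 1 - n = beta p i" by blast
    then have "- 1 - n \<in> B" using sub by simp
    with that show False using bal unfolding balanced_def by blast
  qed
  with sub have "range (beta p) = B" by blast
  with part sc show ?thesis by blast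
qed

lemma bdd_above_range_beta:
  assumes "is_partition p"
  shows "bdd_above (range (beta p))"
proof (rule bdd_aboveI[of _ "int (row p 0)"])
  fix n assume "n \<in> range (beta p)"
  then obtain i where "n = beta p i" by blast
  then show "n \<le> int (row p 0)"
    using row_antimono[OF assms, of 0 i] by (simp add: beta_def)
qed

lemma bij_betw_self_conjugate_cores:
  assumes "\<And>t. t \<in> T \<Longrightarrow> 0 < t"
  shows "bij_betw (\<lambda>p. range (beta p)) (self_conjugate_cores T)
    {B. balanced B \<and> bdd_above B \<and> (\<forall>t\<in>T. closed_under (int t) B)}"
proof (rule bij_betwI')
  fix p q assume "p \<in> self_conjugate_cores T" "q \<in> self_conjugate_cores T"
  then show "(range (beta p) = range (beta q)) = (p = q)"
    using range_beta_inj by (auto simp: self_conjugate_cores_def)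
next
  fix p assume "p \<in> self_conjugate_cores T"
  then show "range (beta p) \<in> {B. balanced B \<and> bdd_above B \<and> (\<forall>t\<in>T. closed_under (int t) B)}"
    using assms balanced_range_beta bdd_above_range_beta is_core_iff_closed_under
    by (auto simp: self_conjugate_cores_def)
next
  fix B assume B: "B \<in> {B. balanced B \<and> bdd_above B \<and> (\<forall>t\<in>T. closed_under (int t) B)}"
  then obtain p where "is_partition p" "self_conjugate p" "range (beta p) = B"
    using range_beta_surj by blast
  with B show "\<exists>p\<in>self_conjugate_cores T. B = range (beta p)"
    using assms is_core_iff_closed_under
    by (intro bexI[of _ p]) (auto simp: self_conjugate_cores_def)
qed

section \<open>Lattice coordinates and profiles\<close>

lemma int_downset_eq_atMost:
  fixes S :: "int set"
  assumes down: "\<And>u. u \<in> S \<Longrightarrow> u - 1 \<in> S" and "S \<noteq> {}" "bdd_above S"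
  shows "\<exists>h. S = {..h}"
proof -
  have down': "u - int n \<in> S" if "u \<in> S" for u n
  proof (induction n)
    case (Suc n)
    then show ?case using down[of "u - int n"] by (simp add: algebra_simps)
  qed (use that in simp)
  obtain s where s: "s \<in> S" using assms(2) by blast
  obtain M where M: "\<And>u. u \<in> S \<Longrightarrow> u \<le> M" using assms(3) unfolding bdd_above_def by blast
  let ?T = "{u \<in> S. s \<le> u}"
  have fin: "finite ?T" by (rule finite_subset[of _ "{s..M}"]) (use M in auto)
  have "Max ?T \<in> ?T" by (rule Max_in[OF fin]) (use s in auto)
  then have max: "Max ?T \<in> S" "s \<le> Max ?T" by auto
  have "S = {..Max ?T}"
  proof (intro equalityI subsetI)
    fix u assume "u \<in> {..Max ?T}"
    then show "u \<in> S" using down'[OF max(1), of "nat (Max ?T - u)"] by simp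
  next
    fix u assume "u \<in> S"
    then have "u \<le> Max ?T" using max(2) Max_ge[OF fin, of u] by (cases "s \<le> u") auto
    then show "u \<in> {..Max ?T}" by simp
  qed
  then show ?thesis by blast
qed

text \<open>Here \<open>a = s + d\<close>, and \<open>e\<close> is \<open>0\<close> or \<open>1\<close> according to whether \<open>a\<close> is odd or even. The origin
  \<open>n0\<close> is chosen so that \<open>n \<mapsto> -1 - n\<close> becomes \<open>(u, x) \<mapsto> (1 - u, -e - x)\<close>.\<close>

locale core_lattice =
  fixes a d e n0 :: int
  assumes coprime: "coprime a d" and d_pos: "0 < d" and d_less: "d < a"
    and e_cases: "e = 0 \<or> e = 1" and n0: "2 * n0 = e * d - a - 1"
begin

text \<open>In these coordinates, subtracting \<open>a - d\<close>, \<open>a\<close> or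
  \<open>a + d\<close> lowers \<open>u\<close> by 1 and changes \<open>x\<close> by 1, 0 or -1
  respectively.\<close>

definition pt :: "int \<Rightarrow> int \<Rightarrow> int" where
  "pt u x = n0 + a * u + d * x"

lemma pt_reflect: "- 1 - pt u x = pt (1 - u) (- e - x)"
  using n0 by (simp add: pt_def algebra_simps)

lemma pt_eqD:
  assumes "pt u x = pt u' x'"
  shows "\<exists>t. x' = x + a * t \<and> u = u' + d * t"
proof -
  have eq: "a * (u - u') = d * (x' - x)" using assms by (simp add: pt_def algebra_simps)
  then have "a dvd d * (x' - x)" by (metis dvd_triv_left)
  then have "a dvd x' - x" using coprime by (simp add: coprime_dvd_mult_right_iff)
  then obtain t where t: "x' - x = a * t" by blast
  then have "a * (u - u') = a * (d * t)" using eq by (simp add: algebra_simps)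
  then have "u - u' = d * t" using d_pos d_less by simp
  with t have "x' = x + a * t \<and> u = u' + d * t" by linarith
  then show ?thesis by blast
qed

lemma ex_pt: "\<exists>u x. 0 \<le> x \<and> x < a \<and> n = pt u x"
proof -
  obtain p q where "p * a + q * d = gcd a d" using bezout_int by blast
  then have pq: "p * a + q * d = 1" using coprime by simp
  define x0 u0 where "x0 = q * (n - n0)" and "u0 = p * (n - n0)"
  have "a * u0 + d * x0 = (p * a + q * d) * (n - n0)"
    by (simp add: x0_def u0_def algebra_simps)
  then have 1: "a * u0 + d * x0 = n - n0" using pq by simp
  have "n = pt (u0 + d * (x0 div a)) (x0 mod a)"
    using 1 by (simp add: pt_def minus_div_mult_eq_mod[symmetric] algebra_simps)
  moreover have "0 \<le> x0 mod a" "x0 mod a < a" using d_pos d_less by simp_all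
  ultimately show ?thesis by blast
qed

text \<open>The conjuncts come, in order, from closure under \<open>a - d\<close> and
  \<open>a + d\<close>, from the two names \<open>pt u (x + a) = pt (u + d) x\<close> of one
  integer, and from balance.\<close>

definition profile :: "(int \<Rightarrow> int) \<Rightarrow> bool" where
  "profile H \<longleftrightarrow> (\<forall>x. \<bar>H (x + 1) - H x\<bar> \<le> 1) \<and> (\<forall>x. H (x + a) = H x - d)
    \<and> (\<forall>x. H (- e - x) = - H x)"

definition below :: "(int \<Rightarrow> int) \<Rightarrow> int set" where
  "below H = {n. \<exists>u x. n = pt u x \<and> u \<le> H x}"

lemma profile_shift:
  assumes "profile H"
  shows "H (x + a * t) = H x - d * t"
proof -
  have per: "H (y + a) = H y - d" for y using assms by (simp add: profile_def)
  have nat: "H (y + a * int n) = H y - d * int n" for y n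
  proof (induction n)
    case (Suc n)
    have "y + a * int (Suc n) = (y + a * int n) + a" by (simp add: algebra_simps)
    then show ?case using Suc per[of "y + a * int n"] by (simp add: algebra_simps)
  qed simp
  show ?thesis
    using nat[of x "nat t"] nat[of "x + a * t" "nat (- t)"] by (cases "t \<ge> 0") auto
qed

text \<open>The choice of coordinates is immaterial: passing to another pair shifts \<open>u\<close>
  and \<open>H x\<close> by the same multiple of \<open>d\<close>.\<close>

lemma mem_below:
  assumes "profile H"
  shows "pt u x \<in> below H \<longleftrightarrow> u \<le> H x"
proof
  assume "pt u x \<in> below H"
  then obtain u' x' where "pt u x = pt u' x'" and le: "u' \<le> H x'" by (auto simp: below_def)
  then obtain t where t: "x' = x + a * t" "u = u' + d * t" using pt_eqD by blast
  show "u \<le> H x" using le profile_shift[OF assms, of x t] by (simp add: t)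
qed (auto simp: below_def)

lemma below_in:
  assumes "profile H"
  shows "balanced (below H)" "bdd_above (below H)"
    "closed_under (a - d) (below H)" "closed_under a (below H)" "closed_under (a + d) (below H)"
proof -
  note mem = mem_below[OF assms]
  have step: "\<bar>H (x + 1) - H x\<bar> \<le> 1" and refl: "H (- e - x) = - H x" for x
    using assms by (auto simp: profile_def)
  show "balanced (below H)"
    unfolding balanced_def
  proof
    fix n
    obtain u x where n: "n = pt u x" using ex_pt by blast
    show "n \<in> below H \<longleftrightarrow> - 1 - n \<notin> below H"
      unfolding n pt_reflect mem refl by linarith
  qed
  show "bdd_above (below H)"
  proof (rule bdd_aboveI)
    fix n assume "n \<in> below H"
    obtain u x where n: "n = pt u x" and x: "0 \<le> x" "x < a" using ex_pt by blast
    have "u \<le> H x" using \<open>n \<in> below H\<close> n mem by simp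
    \<comment> \<open>Every integer has coordinates with \<open>x\<close> in one period, so finitely
      many values of \<open>H\<close> bound the whole set.\<close>
    also have "H x \<le> Max (H ` {0..<a})" using x by (intro Max_ge) auto
    finally have "a * u \<le> a * Max (H ` {0..<a})" using d_pos d_less by simp
    moreover have "d * x \<le> d * a" using x d_pos by simp
    ultimately show "n \<le> n0 + a * Max (H ` {0..<a}) + d * a" by (simp add: n pt_def)
  qed
  have "n - (a - d) \<in> below H \<and> n - a \<in> below H \<and> n - (a + d) \<in> below H" if "n \<in> below H" for n
  proof -
    obtain u x where n: "n = pt u x" using ex_pt by blast
    have eqs: "n - (a - d) = pt (u - 1) (x + 1)" "n - a = pt (u - 1) x"
      "n - (a + d) = pt (u - 1) (x - 1)"
      by (simp_all add: n pt_def algebra_simps)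
    have "u \<le> H x" using that n mem by simp
    then show ?thesis unfolding eqs mem using step[of x] step[of "x - 1"] by auto
  qed
  then show "closed_under (a - d) (below H)" "closed_under a (below H)" "closed_under (a + d) (below H)"
    by (simp_all add: closed_under_def)
qed

lemma below_inj:
  assumes "profile H" "profile H'" "below H = below H'"
  shows "H = H'"
proof
  fix x
  have "u \<le> H x \<longleftrightarrow> u \<le> H' x" for u
    using mem_below[OF assms(1), of u x] mem_below[OF assms(2), of u x] assms(3) by simp
  then show "H x = H' x" by (meson order_antisym order_refl)
qed

text \<open>For fixed \<open>x\<close>, closure under \<open>a\<close> makes the admissible
  \<open>u\<close> a downset; its maximum serves as \<open>H x\<close>.\<close>

lemma below_surj:
  assumes bal: "balanced B" and bdd: "bdd_above B" and cl: "closed_under (a - d) B"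
    "closed_under a B" "closed_under (a + d) B"
  shows "\<exists>H. profile H \<and> below H = B"
proof -
  have a_pos: "0 < a" using d_pos d_less by simp
  obtain M where M: "\<And>n. n \<in> B \<Longrightarrow> n \<le> M" using bdd unfolding bdd_above_def by blast
  have refl: "pt u x \<in> B \<longleftrightarrow> pt (1 - u) (- e - x) \<notin> B" for u x
    using bal unfolding balanced_def pt_reflect[symmetric] by (rule spec)
  have bound: "u \<le> max 0 (M - n0 - d * x)" if "pt u x \<in> B" for u x
  proof (cases "u \<le> 0")
    case False
    then have "1 * u \<le> a * u" using a_pos by (intro mult_right_mono) auto
    with M[OF that] show ?thesis by (simp add: pt_def)
  qed simp
  have "\<exists>h. \<forall>u. pt u x \<in> B \<longleftrightarrow> u \<le> h" for x
  proof -
    have "\<exists>h. {u. pt u x \<in> B} = {..h}"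
    proof (rule int_downset_eq_atMost)
      fix u assume "u \<in> {u. pt u x \<in> B}"
      moreover have "pt (u - 1) x = pt u x - a" by (simp add: pt_def algebra_simps)
      ultimately show "u - 1 \<in> {u. pt u x \<in> B}" using cl(2) by (simp add: closed_under_def)
    next
      show "{u. pt u x \<in> B} \<noteq> {}"
      proof
        assume "{u. pt u x \<in> B} = {}"
        \<comment> \<open>An empty fibre over \<open>x\<close> would, by balance, put the whole
          fibre over \<open>- e - x\<close> into \<open>B\<close>, which boundedness
          forbids.\<close>
        then have "pt u (- e - x) \<in> B" for u using refl[of "1 - u" x] by simp
        from bound[OF this, of "max 0 (M - n0 - d * (- e - x)) + 1"] show False by simp
      qed
      show "bdd_above {u. pt u x \<in> B}" using bound by (intro bdd_aboveI) blast
    qed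
    then show ?thesis by blast
  qed
  then obtain H where H: "\<And>x u. pt u x \<in> B \<longleftrightarrow> u \<le> H x" by metis
  have up: "H x - 1 \<le> H (x + 1)" and down: "H x - 1 \<le> H (x - 1)" for x
  proof -
    have "pt (H x) x \<in> B" using H by simp
    then have "pt (H x) x - (a - d) \<in> B" "pt (H x) x - (a + d) \<in> B"
      using cl by (simp_all add: closed_under_def)
    moreover have "pt (H x) x - (a - d) = pt (H x - 1) (x + 1)"
      "pt (H x) x - (a + d) = pt (H x - 1) (x - 1)"
      by (simp_all add: pt_def algebra_simps)
    ultimately show "H x - 1 \<le> H (x + 1)" "H x - 1 \<le> H (x - 1)" using H by simp_all
  qed
  have 1: "\<bar>H (x + 1) - H x\<bar> \<le> 1" for x
    using up[of x] down[of "x + 1"] by simp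
  have 2: "H (x + a) = H x - d" for x
  proof -
    have "u \<le> H (x + a) \<longleftrightarrow> u + d \<le> H x" for u
    proof -
      have "pt u (x + a) = pt (u + d) x" by (simp add: pt_def algebra_simps)
      then show ?thesis using H by metis
    qed
    from this[of "H (x + a)"] this[of "H x - d"] show ?thesis by simp
  qed
  have 3: "H (- e - x) = - H x" for x
  proof -
    have "u \<le> H x \<longleftrightarrow> \<not> 1 - u \<le> H (- e - x)" for u
      using refl[of u x] unfolding H .
    from this[of "H x"] this[of "H x + 1"] show ?thesis by simp
  qed
  have prof: "profile H" using 1 2 3 by (simp add: profile_def)
  have "n \<in> below H \<longleftrightarrow> n \<in> B" for n
  proof -
    obtain u x where n: "n = pt u x" using ex_pt by blast
    show ?thesis unfolding n H mem_below[OF prof] ..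
  qed
  then have "below H = B" by blast
  with prof show ?thesis by blast
qed

lemma bij_betw_below:
  "bij_betw below {H. profile H} {B. balanced B \<and> bdd_above B \<and>
    closed_under (a - d) B \<and> closed_under a B \<and> closed_under (a + d) B}"
proof (rule bij_betwI')
  fix H H' assume "H \<in> {H. profile H}" "H' \<in> {H. profile H}"
  then show "(below H = below H') = (H = H')" using below_inj by blast
next
  fix H assume "H \<in> {H. profile H}"
  then show "below H \<in> {B. balanced B \<and> bdd_above B \<and>
    closed_under (a - d) B \<and> closed_under a B \<and> closed_under (a + d) B}"
    using below_in by simp
next
  fix B assume "B \<in> {B. balanced B \<and> bdd_above B \<and>
    closed_under (a - d) B \<and> closed_under a B \<and> closed_under (a + d) B}"
  then show "\<exists>H\<in>{H. profile H}. B = below H" using below_surj[of B] by auto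
qed

end

section \<open>Profiles as lattice paths\<close>

definition bounded_paths :: "nat \<Rightarrow> int \<Rightarrow> int list set" where
  "bounded_paths k d = {w. length w = k \<and> set w \<subseteq> {-1, 0, 1} \<and> \<bar>2 * sum_list w + d\<bar> \<le> 1}"

lemma sum_list_take_Suc:
  fixes w :: "int list"
  assumes "i < length w"
  shows "sum_list (take (Suc i) w) = sum_list (take i w) + w ! i"
  using assms by (simp add: take_Suc_conv_app_nth)

context core_lattice
begin

definition steps :: "nat \<Rightarrow> (int \<Rightarrow> int) \<Rightarrow> int list" where
  "steps k H = map (\<lambda>i. H (int i + 1) - H (int i)) [0..<k]"

text \<open>For \<open>e = 0\<close> the centre of symmetry is 0 itself. For \<open>e = 1\<close> it
  is -1/2, and the step across it equals \<open>2 * H 0\<close>, an even number of absolute value at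
  most 1.\<close>

lemma profile_0:
  assumes "profile H"
  shows "H 0 = 0"
proof -
  have "H (- e) = - H 0" "\<bar>H 0 - H (- 1)\<bar> \<le> 1"
    using assms by (metis diff_0_right diff_zero profile_def, metis add.left_inverse profile_def)
  then show ?thesis using e_cases by auto
qed

lemma sum_list_take_steps:
  assumes "profile H" "i \<le> k"
  shows "sum_list (take i (steps k H)) = H (int i)"
  using assms(2)
proof (induction i)
  case 0
  then show ?case by (simp add: profile_0[OF assms(1)])
next
  case (Suc i)
  then have "sum_list (take (Suc i) (steps k H)) = H (int i) + steps k H ! i"
    by (subst sum_list_take_Suc) (simp_all add: steps_def)
  then show ?case using Suc.prems by (simp add: steps_def add.commute)
qed

context
  fixes k :: nat
  assumes k: "a = 2 * int k + 1 + e"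
begin

text \<open>The window from \<open>- e - k\<close> to \<open>k\<close> has exactly \<open>a\<close>
  elements and is mapped to itself by \<open>x \<mapsto> - e - x\<close>, so it is a period adapted
  to the symmetry.\<close>

lemma ex_window: "\<exists>q r. x = a * q + r \<and> - e - int k \<le> r \<and> r \<le> int k"
proof (intro exI conjI)
  let ?y = "x + int k + e"
  have a: "0 < a" using d_pos d_less by simp
  show "x = a * (?y div a) + (?y mod a - int k - e)" by (simp add: algebra_simps)
  show "- e - int k \<le> ?y mod a - int k - e" using pos_mod_sign[OF a, of ?y] by simp
  show "?y mod a - int k - e \<le> int k" using pos_mod_bound[OF a, of ?y] k by simp
qed

lemma window_unique:
  assumes "a * q + r = a * q' + r'" "- e - int k \<le> r" "r \<le> int k" "- e - int k \<le> r'" "r' \<le> int k"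
  shows "q = q' \<and> r = r'"
proof -
  have a: "0 < a" using d_pos d_less by simp
  have *: "(a * q + r + int k + e) div a = q" if "- e - int k \<le> r" "r \<le> int k" for q r
  proof -
    have "(r + int k + e) div a = 0" using that k by (intro div_pos_pos_trivial) auto
    moreover have "a * q + r + int k + e = (r + int k + e) + q * a" by (simp add: algebra_simps)
    ultimately show ?thesis using a by (simp only: div_mult_self1)
  qed
  have "q = q'" using *[OF assms(2,3), of q] *[OF assms(4,5), of q'] assms(1) by simp
  then show ?thesis using assms(1) by simp
qed

lemma steps_in:
  assumes H: "profile H"
  shows "steps k H \<in> bounded_paths k d"
proof -
  have step: "\<bar>H (x + 1) - H x\<bar> \<le> 1" and per: "H (x + a) = H x - d"
    and refl: "H (- e - x) = - H x" for x
    using H by (auto simp: profile_def)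
  have "sum_list (steps k H) = H (int k)"
    using sum_list_take_steps[OF H, of k k] by (simp add: steps_def)
  \<comment> \<open>The step leaving the window \<open>[-e - k, k]\<close> is determined by periodicity and symmetry; that it is
    \<open>-1\<close>, \<open>0\<close> or \<open>1\<close> is the condition on the endpoint of the path.\<close>
  moreover have "H (int k + 1) = - H (int k) - d"
  proof -
    have "H (int k + 1) = H (- e - int k + a)" using k by (simp add: algebra_simps)
    then show ?thesis by (simp add: per refl)
  qed
  moreover have "H (x + 1) - H x \<in> {-1, 0, 1}" for x
    using step[of x] by auto
  then have "set (steps k H) \<subseteq> {-1, 0, 1}" by (auto simp: steps_def simp del: insert_iff)
  ultimately show ?thesis using step[of "int k"] by (simp add: bounded_paths_def steps_def)
qed

text \<open>The steps and \<open>H 0 = 0\<close> fix \<open>H\<close> on \<open>0..k\<close>,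
  oddness extends this to the window, and the shift rule to all integers.\<close>

lemma steps_inj:
  assumes H: "profile H" and H': "profile H'" and eq: "steps k H = steps k H'"
  shows "H = H'"
proof
  fix x
  have nonneg: "H r = H' r" if "0 \<le> r" "r \<le> int k" for r
    using that sum_list_take_steps[OF H, of "nat r" k] sum_list_take_steps[OF H', of "nat r" k] eq
    by simp
  have window: "H r = H' r" if "- e - int k \<le> r" "r \<le> int k" for r
  proof (cases "0 \<le> r")
    case False
    have refl: "H (- e - y) = - H y" "H' (- e - y) = - H' y" for y
      using H H' by (auto simp: profile_def)
    have "H (- e - r) = H' (- e - r)" using False that e_cases by (intro nonneg) auto
    then show ?thesis by (simp add: refl)
  qed (use that nonneg in simp)
  obtain q r where x: "x = r + a * q" "- e - int k \<le> r" "r \<le> int k"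
    using ex_window[of x] by (auto simp: add.commute)
  show "H x = H' x"
    unfolding x(1) profile_shift[OF H] profile_shift[OF H'] using window[OF x(2,3)] by simp
qed

text \<open>Partial sums give \<open>g\<close> on \<open>0..k\<close>, \<open>G\<close> is the odd
  extension to the window, and \<open>H\<close> the extension by the shift rule. The steps not read
  off from \<open>w\<close> or its reflection are the one across the centre when
  \<open>e = 1\<close> and those between adjacent windows.\<close>

lemma steps_surj:
  assumes "w \<in> bounded_paths k d"
  shows "\<exists>H. profile H \<and> steps k H = w"
proof -
  have len: "length w = k" and w: "set w \<subseteq> {-1, 0, 1}" and fin: "\<bar>2 * sum_list w + d\<bar> \<le> 1"
    using assms by (auto simp: bounded_paths_def)
  define g where "g i = sum_list (take i w)" for i
  define G where "G r = (if 0 \<le> r then g (nat r) else - g (nat (- e - r)))" for r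
  define H where "H x = G ((x + int k + e) mod a - int k - e) - d * ((x + int k + e) div a)" for x
  have g0: "g 0 = 0" by (simp add: g_def)
  have gk: "\<bar>2 * g k + d\<bar> \<le> 1" using fin len by (simp add: g_def)
  have g_Suc: "g (Suc i) = g i + w ! i" if "i < k" for i
    using that len by (simp add: g_def sum_list_take_Suc)
  have g_step: "\<bar>g (Suc i) - g i\<bar> \<le> 1" if "i < k" for i
  proof -
    have "w ! i \<in> {-1, 0, 1}" using w that len nth_mem by blast
    then show ?thesis using g_Suc[OF that] by auto
  qed
  have G_refl: "G (- e - r) = - G r" if "- e - int k \<le> r" "r \<le> int k" for r
    using e_cases g0 by (auto simp: G_def)
  have G_step_nonneg: "\<bar>G (r + 1) - G r\<bar> \<le> 1" if "0 \<le> r" "r < int k" for r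
    using that g_step[of "nat r"] by (simp add: G_def nat_add_distrib)
  have G_step: "\<bar>G (r + 1) - G r\<bar> \<le> 1" if r: "- e - int k \<le> r" "r < int k" for r
  proof -
    \<comment> \<open>Right of the centre the step is one of \<open>w\<close>; left of it, a
      reflected one. For \<open>e = 1\<close> the step from -1 to 0 joins two zeros of
      \<open>G\<close>.\<close>
    consider "0 \<le> r" | "r + 1 \<le> - e" | "e = 1" "r = - 1" using e_cases by linarith
    then show ?thesis
    proof cases
      case 2
      have "\<bar>G (- e - r - 1 + 1) - G (- e - r - 1)\<bar> \<le> 1" using 2 r by (intro G_step_nonneg) auto
      moreover have "G (- e - r) = - G r" "G (- e - (r + 1)) = - G (r + 1)"
        using r by (auto intro!: G_refl)
      ultimately show ?thesis by (simp add: algebra_simps)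
    qed (use G_step_nonneg r g0 in \<open>auto simp: G_def\<close>)
  qed
  have H: "H (a * q + r) = G r - d * q" if r: "- e - int k \<le> r" "r \<le> int k" for q r
  proof -
    let ?y = "a * q + r + int k + e"
    have "a * q + r = a * (?y div a) + (?y mod a - int k - e)" by (simp add: algebra_simps)
    moreover have "0 < a" using d_pos d_less by simp
    then have "0 \<le> ?y mod a" "?y mod a < a" by simp_all
    then have "- e - int k \<le> ?y mod a - int k - e" "?y mod a - int k - e \<le> int k"
      using k by linarith+
    ultimately have "q = ?y div a \<and> r = ?y mod a - int k - e"
      using r by (intro window_unique)
    then show ?thesis unfolding H_def by metis
  qed
  have "profile H"
    unfolding profile_def
  proof (intro conjI allI)
    fix x
    obtain q r where x: "x = a * q + r" and r: "- e - int k \<le> r" "r \<le> int k"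
      using ex_window by blast
    have "H (a * (q + 1) + r) = G r - d * (q + 1)" by (rule H[OF r])
    then show "H (x + a) = H x - d" using H[OF r, of q] by (simp add: x algebra_simps)
    have "H (a * (- q) + (- e - r)) = G (- e - r) - d * (- q)" using r by (intro H) auto
    then show "H (- e - x) = - H x" using H[OF r, of q] G_refl[OF r] by (simp add: x algebra_simps)
    show "\<bar>H (x + 1) - H x\<bar> \<le> 1"
    proof (cases "r = int k")
      case False
      then have "H (a * q + (r + 1)) = G (r + 1) - d * q" using r by (intro H) auto
      then show ?thesis using H[OF r, of q] G_step[of r] False r by (simp add: x algebra_simps)
    next
      case True
      \<comment> \<open>Here \<open>x + 1\<close> is the left end of the next window, and the step
        is \<open>- 2 * g k - d\<close>, bounded by the endpoint condition on
        \<open>w\<close>.\<close>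
      have "H (a * (q + 1) + (- e - int k)) = G (- e - int k) - d * (q + 1)"
        using e_cases by (intro H) auto
      moreover have "a * (q + 1) + (- e - int k) = x + 1" using True k by (simp add: x algebra_simps)
      moreover have "G (- e - int k) = - G (int k)" using e_cases by (intro G_refl) auto
      moreover have "G (int k) = g k" by (simp add: G_def)
      ultimately show ?thesis using H[OF r, of q] True gk by (simp add: x algebra_simps)
    qed
  qed
  moreover have "steps k H = w"
  proof (rule nth_equalityI)
    fix i assume "i < length (steps k H)"
    then have i: "i < k" by (simp add: steps_def)
    have "H (int i) = g i" "H (int i + 1) = g (Suc i)"
      using H[of "int i" 0] H[of "int i + 1" 0] i e_cases by (auto simp: G_def nat_add_distrib)
    then show "steps k H ! i = w ! i" using i g_Suc[OF i] by (simp add: steps_def)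
  qed (simp add: steps_def len)
  ultimately show ?thesis by blast
qed

lemma bij_betw_steps: "bij_betw (steps k) {H. profile H} (bounded_paths k d)"
proof (rule bij_betwI')
  fix w assume "w \<in> bounded_paths k d"
  then show "\<exists>H\<in>{H. profile H}. w = steps k H" using steps_surj by force
qed (use steps_inj steps_in in auto)

end

end

section \<open>Counting paths by their numbers of up, down and level steps\<close>

text \<open>Phrased through multiset permutations because their cardinality is a known quotient of
  factorials.\<close>

definition composition_lists :: "nat \<Rightarrow> nat \<Rightarrow> nat \<Rightarrow> int list set" where
  "composition_lists x y z =
    permutations_of_multiset (replicate_mset x 1 + replicate_mset y (-1) + replicate_mset z 0)"

lemma finite_composition_lists: "finite (composition_lists x y z)"
  by (simp add: composition_lists_def)

lemma card_composition_lists: "card (composition_lists x y z) = trinomial (x + y + z) x y z"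
proof -
  let ?M = "replicate_mset x 1 + replicate_mset y (-1) + replicate_mset z (0 :: int)"
  \<comment> \<open>A value of multiplicity 0 is absent from \<open>set_mset ?M\<close> but
    contributes only the factor \<open>fact 0 = 1\<close>.\<close>
  have "(\<Prod>v\<in>set_mset ?M. fact (count ?M v) :: nat) = (\<Prod>v\<in>{1, -1, 0}. fact (count ?M v))"
    by (rule prod.mono_neutral_left) (auto split: if_splits simp: not_in_iff)
  also have "\<dots> = fact x * fact y * fact z" by simp
  finally show ?thesis
    by (simp add: composition_lists_def card_permutations_of_multiset trinomial_def)
qed

lemma mem_composition_lists:
  "w \<in> composition_lists x y z \<longleftrightarrow>
    set w \<subseteq> {-1, 0, 1} \<and> count_list w 1 = x \<and> count_list w (-1) = y \<and> count_list w 0 = z"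
proof -
  have "w \<in> composition_lists x y z \<longleftrightarrow>
      (\<forall>v. count_list w v = (if v = 1 then x else 0) + (if v = -1 then y else 0) + (if v = 0 then z else 0))"
    by (auto simp: composition_lists_def permutations_of_multiset_def multiset_eq_iff count_mset eq_commute)
  also have "\<dots> \<longleftrightarrow>
      set w \<subseteq> {-1, 0, 1} \<and> count_list w 1 = x \<and> count_list w (-1) = y \<and> count_list w 0 = z"
    (is "?l \<longleftrightarrow> ?r")
  proof
    assume l: ?l
    have "v \<in> {-1, 0, 1}" if "v \<in> set w" for v
      using that l[rule_format, of v] by (auto simp: count_list_0_iff split: if_splits)
    with l show ?r by auto
  next
    assume r: ?r
    then have "count_list w v = 0" if "v \<notin> {-1, 0, 1}" for v
      using that by (auto simp: count_list_0_iff)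
    with r show ?l by auto
  qed
  finally show ?thesis .
qed

lemma sum_length_of_signs:
  fixes w :: "int list"
  assumes "set w \<subseteq> {-1, 0, 1}"
  shows "sum_list w = int (count_list w 1) - int (count_list w (-1))"
    and "length w = count_list w 1 + count_list w (-1) + count_list w 0"
  using assms by (induction w) auto

text \<open>Paths are sorted by their step counts, with \<open>I\<close> indexing the admissible
  triples. Injectivity of \<open>z\<close> keeps the classes disjoint, since the number of level
  steps already tells them apart.\<close>

lemma card_bounded_paths:
  assumes inj: "inj_on z I" and "finite I"
    and len: "\<And>i. i \<in> I \<Longrightarrow> x i + y i + z i = k"
    and bounded: "\<And>i. i \<in> I \<Longrightarrow> \<bar>2 * (int (x i) - int (y i)) + d\<bar> \<le> 1"
    and surj: "\<And>p q r. p + q + r = k \<Longrightarrow> \<bar>2 * (int p - int q) + d\<bar> \<le> 1 \<Longrightarrow>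
      \<exists>i\<in>I. x i = p \<and> y i = q \<and> z i = r"
  shows "finite (bounded_paths k d) \<and>
    card (bounded_paths k d) = (\<Sum>i\<in>I. trinomial k (x i) (y i) (z i))"
proof -
  have eq: "bounded_paths k d = (\<Union>i\<in>I. composition_lists (x i) (y i) (z i))"
  proof (intro equalityI subsetI)
    fix w assume "w \<in> bounded_paths k d"
    then have w: "length w = k" "set w \<subseteq> {-1, 0, 1}" "\<bar>2 * sum_list w + d\<bar> \<le> 1"
      by (auto simp: bounded_paths_def)
    with sum_length_of_signs[OF w(2)] surj[of "count_list w 1" "count_list w (-1)" "count_list w 0"]
    obtain i where "i \<in> I" "x i = count_list w 1" "y i = count_list w (-1)" "z i = count_list w 0"
      by auto
    with w(2) have "w \<in> composition_lists (x i) (y i) (z i)" by (simp add: mem_composition_lists)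
    with \<open>i \<in> I\<close> show "w \<in> (\<Union>i\<in>I. composition_lists (x i) (y i) (z i))" by blast
  next
    fix w assume "w \<in> (\<Union>i\<in>I. composition_lists (x i) (y i) (z i))"
    then obtain i where i: "i \<in> I" "set w \<subseteq> {-1, 0, 1}" "count_list w 1 = x i"
      "count_list w (-1) = y i" "count_list w 0 = z i"
      by (auto simp: mem_composition_lists)
    then show "w \<in> bounded_paths k d"
      using sum_length_of_signs[OF i(2)] len[OF i(1)] bounded[OF i(1)]
      by (simp add: bounded_paths_def)
  qed
  have disj: "composition_lists (x i) (y i) (z i) \<inter> composition_lists (x j) (y j) (z j) = {}"
    if "i \<in> I" "j \<in> I" "i \<noteq> j" for i j
    using that inj by (auto simp: mem_composition_lists inj_on_def)
  have "card (bounded_paths k d) = (\<Sum>i\<in>I. card (composition_lists (x i) (y i) (z i)))"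
    unfolding eq using \<open>finite I\<close> disj
    by (intro card_UN_disjoint) (auto simp: finite_composition_lists)
  also have "\<dots> = (\<Sum>i\<in>I. trinomial k (x i) (y i) (z i))"
    using len by (intro sum.cong) (auto simp: card_composition_lists)
  finally show ?thesis
    using \<open>finite I\<close> by (simp add: eq finite_composition_lists)
qed

text \<open>For even \<open>d\<close> the bounded quantity is even, hence 0: there are exactly
  \<open>d div 2\<close> more down steps than up steps, and \<open>i\<close> counts the up
  steps.\<close>

lemma card_bounded_paths_even:
  assumes "odd s" "even d"
  shows "finite (bounded_paths ((s + d - 1) div 2) (int d)) \<and>
    card (bounded_paths ((s + d - 1) div 2) (int d)) = (\<Sum>i = 0..s div 4.
      trinomial ((s + d - 1) div 2) i (d div 2 + i) ((s - 1) div 2 - 2 * i))"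
proof (rule card_bounded_paths)
  obtain b c where bc: "s = 2 * b + 1" "d = 2 * c" using assms by (metis oddE evenE)
  have le: "2 * i \<le> b" if "i \<in> {0..s div 4}" for i using that bc by auto
  show "inj_on (\<lambda>i. (s - 1) div 2 - 2 * i) {0..s div 4}"
    using le bc by (intro inj_onI) fastforce
  show "i + (d div 2 + i) + ((s - 1) div 2 - 2 * i) = (s + d - 1) div 2"
    "\<bar>2 * (int i - int (d div 2 + i)) + int d\<bar> \<le> 1" if "i \<in> {0..s div 4}" for i
    using le[OF that] bc by auto
  fix p q r assume *: "p + q + r = (s + d - 1) div 2" "\<bar>2 * (int p - int q) + int d\<bar> \<le> 1"
  have "q = p + c" using *(2) bc by auto
  moreover from this have "2 * p + r = b" using *(1) bc by simp
  ultimately show "\<exists>i\<in>{0..s div 4}. i = p \<and> d div 2 + i = q \<and> (s - 1) div 2 - 2 * i = r"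
    using bc by (intro bexI[of _ p]) auto
qed simp

text \<open>For odd \<open>d\<close> the bounded quantity is 1 or -1; the parity of \<open>i\<close>
  records which, and \<open>i div 2\<close> counts the up steps.\<close>

lemma card_bounded_paths_odd:
  assumes "odd d"
  shows "finite (bounded_paths ((s + d - 1) div 2) (int d)) \<and>
    card (bounded_paths ((s + d - 1) div 2) (int d)) = (\<Sum>i = 0..s div 2.
      trinomial ((s + d - 1) div 2) (i div 2) ((d + i) div 2) (s div 2 - i))"
proof (rule card_bounded_paths)
  obtain c where c: "d = 2 * c + 1" using assms by (metis oddE)
  have k: "(s + d - 1) div 2 = s div 2 + c" using c by simp
  show "inj_on (\<lambda>i. s div 2 - i) {0..s div 2}"
    by (intro inj_onI) auto
  show "i div 2 + (d + i) div 2 + (s div 2 - i) = (s + d - 1) div 2"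
    "\<bar>2 * (int (i div 2) - int ((d + i) div 2)) + int d\<bar> \<le> 1" if "i \<in> {0..s div 2}" for i
  proof -
    have div: "(d + i) div 2 = c + (i + 1) div 2" and "i div 2 + (i + 1) div 2 = i"
      unfolding c by presburger+
    then have "i div 2 + (d + i) div 2 = c + i" by simp
    with that show "i div 2 + (d + i) div 2 + (s div 2 - i) = (s + d - 1) div 2"
      unfolding k by simp
    show "\<bar>2 * (int (i div 2) - int ((d + i) div 2)) + int d\<bar> \<le> 1"
      unfolding div c by (cases "even i") (auto elim!: evenE oddE)
  qed
  fix p q r assume pqr: "p + q + r = (s + d - 1) div 2" "\<bar>2 * (int p - int q) + int d\<bar> \<le> 1"
  then have q: "q = p + c \<or> q = p + c + 1" unfolding c by auto
  define i where "i = p + q - c" \<comment> \<open>\<open>2 p\<close> or \<open>2 p + 1\<close>\<close>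
  have "i \<le> s div 2" "i div 2 = p" "(d + i) div 2 = q" "s div 2 - i = r"
    using q pqr(1) unfolding k i_def by (auto simp: c)
  then show "\<exists>i\<in>{0..s div 2}. i div 2 = p \<and> (d + i) div 2 = q \<and> s div 2 - i = r"
    by (intro bexI[of _ i]) auto
qed simp

theorem theorem3p3:
  fixes s d :: nat
  assumes "0 < s" and "0 < d" and "coprime s d"
  shows "finite (self_conjugate_cores {s, s + d, s + 2 * d}) \<and>
    card (self_conjugate_cores {s, s + d, s + 2 * d}) =
      (if even d
       then \<Sum>i = 0..s div 4.
              trinomial ((s + d - 1) div 2) i (d div 2 + i) ((s - 1) div 2 - 2 * i)
       else \<Sum>i = 0..s div 2.
              trinomial ((s + d - 1) div 2) (i div 2) ((d + i) div 2) (s div 2 - i))"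
proof -
  define a e :: int where "a = int s + int d" and "e = (if even (s + d) then 1 else 0)"
  define k where "k = (s + d - 1) div 2"
  have odd: "odd s \<or> odd d"
    using coprime_common_divisor[OF \<open>coprime s d\<close>, of 2] by auto
  \<comment> \<open>This parity makes the origin \<open>n0\<close> an integer. If \<open>a\<close>
    is even, then \<open>s\<close> and \<open>d\<close> are both odd by coprimality, and
    \<open>e = 1\<close> corrects the parity.\<close>
  then have "even (e * int d - a - 1)" by (auto simp: a_def e_def)
  then obtain n0 where "2 * n0 = e * int d - a - 1" by (metis evenE)
  moreover have "coprime a (int d)"
    using \<open>coprime s d\<close> unfolding a_def
    by (metis coprime_int_iff coprime_iff_gcd_eq_1 gcd_add1 of_nat_add)
  ultimately interpret core_lattice a "int d" e n0
    using assms by unfold_locales (auto simp: a_def e_def)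
  have k: "a = 2 * int k + 1 + e"
    using assms unfolding a_def e_def k_def by (cases "even (s + d)") (auto elim!: evenE oddE)
  let ?cores = "self_conjugate_cores {s, s + d, s + 2 * d}"
  let ?sets = "{B. balanced B \<and> bdd_above B \<and>
    closed_under (a - int d) B \<and> closed_under a B \<and> closed_under (a + int d) B}"
  \<comment> \<open>The three core conditions become closure under \<open>a - d = s\<close>,
    \<open>a = s + d\<close> and \<open>a + d = s + 2 * d\<close>.\<close>
  have cores: "bij_betw (\<lambda>p. range (beta p)) ?cores ?sets"
  proof -
    have "\<And>t. t \<in> {s, s + d, s + 2 * d} \<Longrightarrow> 0 < t" using assms by auto
    from bij_betw_self_conjugate_cores[of "{s, s + d, s + 2 * d}", OF this]
    show ?thesis by (simp add: a_def algebra_simps)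
  qed
  have "finite ?cores = finite (bounded_paths k (int d))"
    by (simp only: bij_betw_finite[OF cores] bij_betw_finite[OF bij_betw_below, symmetric]
        bij_betw_finite[OF bij_betw_steps[OF k]])
  moreover have "card ?cores = card (bounded_paths k (int d))"
    by (simp only: bij_betw_same_card[OF cores] bij_betw_same_card[OF bij_betw_below, symmetric]
        bij_betw_same_card[OF bij_betw_steps[OF k]])
  ultimately show ?thesis
    unfolding k_def using card_bounded_paths_even[of s d] card_bounded_paths_odd[of d s] odd
    by (cases "even d") simp_all
qed

end
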